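(* Let $g$ range over a finite set of groups. For each $g$ let $\lambda_{g,1}\ge\lambda_{g,2}\ge\cdots\ge\lambda_{g,d_g}\ge 0$ be a fixed spectrum, where $d_g\ge 1$ is an integer. Suppose each retained direction has the same cost and the budget permits $B$ directions, where $B$ is an integer with $0\le B\le\sum_g d_g$; that is, consider the problem of choosing integers $r_g$ with $0\le r_g\le d_g$ so as to solve $$\min_{\{r_g\}}\ \sum_g\sum_{i=r_g+1}^{d_g}\lambda_{g,i}\quad\text{subject to}\quad \sum_g r_g\le B .$$ Then the following allocation is well defined and optimal: retain the $B$ largest eigenvalues (counted with multiplicity) among all $\lambda_{g,i}$ across all groups, resolving ties so that in each group $g$ the retained eigenvalues form a prefix $\lambda_{g,1},\dots,\lambda_{g,r_g}$. That is, there exist $(r_g)_g$ with $0\le r_g\le d_g$ and $\sum_g r_g=B$ such that the retained values $\{\lambda_{g,i}: i\le r_g\}$ are $B$ largest elements of the multiset of all $\lambda_{g,i}$, and every such $(r_g)_g$ attains the minimum.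
   Context: Each group $g$ (e.g. a value head in some layer) has a local error curve: keeping its $r_g$ leading spectral directions incurs error equal to the spectral tail $\sum_{i>r_g}\lambda_{g,i}$, where $\lambda_{g,1}\ge\cdots\ge\lambda_{g,d_g}\ge0$ are the eigenvalues of a fixed positive semidefinite matrix. The objective is the sum of these tails over groups. In general each retained direction in group $g$ has a cost $c_g$ and the total cost $\sum_g c_g r_g$ is bounded by a budget; here all costs are equal and the budget allows exactly $B$ directions in total, so the constraint is $\sum_g r_g\le B$. *)

theory Defs
  imports Complex_Main "HOL-Library.Multiset"
begin

definition tail_error ::
  "'g set \<Rightarrow> ('g \<Rightarrow> nat) \<Rightarrow> ('g \<Rightarrow> nat \<Rightarrow> real) \<Rightarrow> ('g \<Rightarrow> nat) \<Rightarrow> real" where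
  "tail_error G d lam r = (\<Sum>g\<in>G. \<Sum>i = r g + 1..d g. lam g i)"

definition feasible ::
  "'g set \<Rightarrow> ('g \<Rightarrow> nat) \<Rightarrow> nat \<Rightarrow> ('g \<Rightarrow> nat) \<Rightarrow> bool" where
  "feasible G d B r \<longleftrightarrow> (\<forall>g\<in>G. r g \<le> d g) \<and> (\<Sum>g\<in>G. r g) \<le> B"

text \<open>Spectra are indexed from 1.  Taking \<open>r = d\<close> gives the multiset of all eigenvalues
  of all groups.\<close>

definition prefix_values ::
  "'g set \<Rightarrow> ('g \<Rightarrow> nat \<Rightarrow> real) \<Rightarrow> ('g \<Rightarrow> nat) \<Rightarrow> real multiset" where
  "prefix_values G lam r = image_mset (\<lambda>(g, i). lam g i) (mset_set (SIGMA g:G. {1..r g}))"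

definition k_largest :: "nat \<Rightarrow> 'a::linorder multiset \<Rightarrow> 'a multiset \<Rightarrow> bool" where
  "k_largest k M N \<longleftrightarrow> M \<subseteq># N \<and> size M = k \<and> (\<forall>x \<in># M. \<forall>y \<in># N - M. y \<le> x)"

definition top_allocation ::
  "'g set \<Rightarrow> ('g \<Rightarrow> nat) \<Rightarrow> ('g \<Rightarrow> nat \<Rightarrow> real) \<Rightarrow> nat \<Rightarrow> ('g \<Rightarrow> nat) \<Rightarrow> bool" where
  "top_allocation G d lam B r \<longleftrightarrow>
     (\<forall>g\<in>G. r g \<le> d g) \<and> (\<Sum>g\<in>G. r g) = B \<and>
     k_largest B (prefix_values G lam r) (prefix_values G lam d)"

end

(*  Retained and discarded eigenvalues are finite sets of positions (g, i).  Greedily retaining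
    the largest next eigenvalue keeps every retained value above every discarded one, because
    each spectrum is nonincreasing.  For such an allocation and any feasible competitor, inject
    the positions that only the first discards into those that only the competitor discards;
    values can only grow along this injection. *)

theory Submission
  imports Defs
begin

abbreviation discarded :: "'g set \<Rightarrow> ('g \<Rightarrow> nat) \<Rightarrow> ('g \<Rightarrow> nat) \<Rightarrow> ('g \<times> nat) set" where
  "discarded G d r \<equiv> SIGMA g:G. {r g + 1..d g}"

text \<open>An exchange argument: the cardinality bound carries over to \<open>A - B\<close> and
  \<open>B - A\<close>, which yields an injection \<open>h\<close> between them. Values do not drop
  along \<open>h\<close>, and \<open>nonneg\<close> covers the elements of \<open>B - A\<close> that
  \<open>h\<close> misses. The common part is then added back on both sides.\<close>

lemma sum_le_sum_card_le:
  fixes f :: "'a \<Rightarrow> 'b::ordered_comm_monoid_add"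
  assumes "finite A" "finite B" "card A \<le> card B"
    and le: "\<And>a b. a \<in> A - B \<Longrightarrow> b \<in> B - A \<Longrightarrow> f a \<le> f b"
    and nonneg: "\<And>b. b \<in> B - A \<Longrightarrow> 0 \<le> f b"
  shows "sum f A \<le> sum f B"
proof -
  have "card (A - B) \<le> card (B - A)"
    using assms by (intro card_le_sym_Diff)
  then obtain h where h: "h ` (A - B) \<subseteq> B - A" "inj_on h (A - B)"
    using assms by (metis card_le_inj finite_Diff)
  have "sum f (A - B) \<le> (\<Sum>a\<in>A - B. f (h a))"
    using h by (intro sum_mono le) auto
  also have "\<dots> = sum f (h ` (A - B))"
    using h by (simp add: sum.reindex)
  also have "\<dots> \<le> sum f (B - A)"
    using h assms by (intro sum_mono2) auto
  finally have "sum f (A \<inter> B) + sum f (A - B) \<le> sum f (A \<inter> B) + sum f (B - A)"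
    by (rule add_left_mono)
  then show ?thesis
    using sum.Int_Diff[of A f B] sum.Int_Diff[of B f A] assms by (simp add: Int_commute)
qed

lemma tail_error_eq_sum_discarded:
  assumes "finite G"
  shows "tail_error G d lam r = (\<Sum>(g, i)\<in>discarded G d r. lam g i)"
  using assms by (simp add: tail_error_def sum.Sigma)

lemma card_discarded:
  assumes "finite G" "\<And>g. g \<in> G \<Longrightarrow> r g \<le> d g"
  shows "card (discarded G d r) = (\<Sum>g\<in>G. d g) - (\<Sum>g\<in>G. r g)"
  using assms by (simp add: sum_subtractf_nat)

text \<open>Passes from multisets of values to positions (g, i), so that ties between equal
  eigenvalues need no further care.\<close>

lemma top_allocation_iff:
  assumes "finite G"
  shows "top_allocation G d lam B r \<longleftrightarrow>
    (\<forall>g\<in>G. r g \<le> d g) \<and> (\<Sum>g\<in>G. r g) = B \<and>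
    (\<forall>g\<in>G. \<forall>i\<in>{1..r g}. \<forall>h\<in>G. \<forall>j\<in>{r h + 1..d h}. lam h j \<le> lam g i)"
proof (cases "\<forall>g\<in>G. r g \<le> d g")
  case True
  let ?R = "SIGMA g:G. {1..r g}" and ?D = "SIGMA g:G. {1..d g}"
  have fin: "finite ?R" "finite ?D"
    using assms by auto
  have sub: "?R \<subseteq> ?D"
    using True by (force dest: bspec)
  then have msub: "mset_set ?R \<subseteq># mset_set ?D"
    using fin by (simp add: subset_imp_msubset_mset_set)
  \<comment> \<open>Because the retained positions lie inside \<open>?D\<close>, taking images
    commutes with the difference, and the multiset left over consists exactly of the values at
    discarded positions.\<close>
  have "?D - ?R = discarded G d r"
    by auto
  then have "prefix_values G lam d - prefix_values G lam r =
      image_mset (\<lambda>(g, i). lam g i) (mset_set (discarded G d r))"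
    using msub fin sub by (simp add: prefix_values_def flip: image_mset_Diff mset_set_Diff)
  moreover have "prefix_values G lam r \<subseteq># prefix_values G lam d"
    using msub by (simp add: prefix_values_def image_mset_subseteq_mono)
  moreover have "size (prefix_values G lam r) = (\<Sum>g\<in>G. r g)"
    using assms by (simp add: prefix_values_def)
  moreover have "set_mset (prefix_values G lam r) = (\<lambda>(g, i). lam g i) ` ?R"
    using fin by (simp add: prefix_values_def)
  moreover have "finite (discarded G d r)"
    using assms by simp
  ultimately show ?thesis
    unfolding top_allocation_def k_largest_def by auto
qed (auto simp: top_allocation_def)

text \<open>Greedy induction on \<open>B\<close>: one more direction goes to a group
  \<open>k\<close> whose first discarded eigenvalue is largest among all groups that are not yet
  full.\<close>

lemma top_allocation_exists:
  assumes "finite G"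
    and anti: "\<And>g. g \<in> G \<Longrightarrow> antimono_on {1..d g} (lam g)"
    and "B \<le> (\<Sum>g\<in>G. d g)"
  shows "\<exists>r. top_allocation G d lam B r"
  using assms(3)
proof (induction B)
  case 0
  have "top_allocation G d lam 0 (\<lambda>_. 0)"
    using assms(1) by (simp add: top_allocation_iff)
  then show ?case
    by (intro exI)
next
  case (Suc B)
  then obtain r where "top_allocation G d lam B r"
    by auto
  then have le: "\<And>g. g \<in> G \<Longrightarrow> r g \<le> d g" and sum: "(\<Sum>g\<in>G. r g) = B"
    and top: "\<And>g i h j. \<lbrakk>g \<in> G; i \<in> {1..r g}; h \<in> G; j \<in> {r h + 1..d h}\<rbrakk> \<Longrightarrow> lam h j \<le> lam g i"
    using assms(1) by (auto simp: top_allocation_iff)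
  let ?C = "{g\<in>G. r g < d g}"
  have fin: "finite ?C"
    using assms(1) by (rule rev_finite_subset) blast
  \<comment> \<open>If every group were full, the total dimension would be at most \<open>B\<close>,
    leaving no room for direction \<open>Suc B\<close>.\<close>
  have "?C \<noteq> {}"
  proof
    assume "?C = {}"
    then have "(\<Sum>g\<in>G. d g) \<le> (\<Sum>g\<in>G. r g)"
      by (intro sum_mono) (auto simp: not_less)
    then show False
      using sum Suc.prems by simp
  qed
  then obtain k where k: "k \<in> ?C"
    and "(MAX g\<in>?C. lam g (r g + 1)) = lam k (r k + 1)"
    by (rule obtains_MAX[of ?C "\<lambda>g. lam g (r g + 1)", OF fin])
  then have k_max: "lam g (r g + 1) \<le> lam k (r k + 1)" if "g \<in> ?C" for g
    using that fin Max_ge[of "(\<lambda>g. lam g (r g + 1)) ` ?C" "lam g (r g + 1)"] by simp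
  \<comment> \<open>Monotonicity within a group reduces any discarded value to the first discarded
    one there, over which \<open>k\<close> was maximal.\<close>
  have next_max: "lam h j \<le> lam k (r k + 1)" if "h \<in> G" "j \<in> {r h + 1..d h}" for h j
  proof -
    have "lam h j \<le> lam h (r h + 1)"
      using that by (intro monotone_onD[OF anti]) auto
    also have "\<dots> \<le> lam k (r k + 1)"
      using that by (intro k_max) auto
    finally show ?thesis .
  qed
  let ?r = "r(k := r k + 1)"
  have "lam h j \<le> lam g i"
    if "g \<in> G" "i \<in> {1..?r g}" "h \<in> G" "j \<in> {?r h + 1..d h}" for g i h j
  proof -
    \<comment> \<open>Whatever \<open>?r\<close> discards was already discarded by \<open>r\<close>.
      Hence \<open>top\<close> handles the old retained positions, and \<open>next_max\<close> the
      single new one.\<close>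
    have j: "j \<in> {r h + 1..d h}"
      using that by (auto split: if_splits)
    show ?thesis
    proof (cases "i \<le> r g")
      case True
      then show ?thesis
        using that j by (intro top) auto
    next
      case False
      then have "g = k" "i = r k + 1"
        using that by (auto split: if_splits)
      then show ?thesis
        using next_max j that by simp
    qed
  qed
  moreover have "(\<Sum>g\<in>G. ?r g) = Suc B"
    using k assms(1) sum by (simp add: sum.remove[of G k])
  ultimately have "top_allocation G d lam (Suc B) ?r"
    using k le assms(1) by (simp add: top_allocation_iff)
  then show ?case
    by (intro exI)
qed

text \<open>The tail error is a sum over discarded positions, so the exchange lemma applies to the
  discarded sets of \<open>r\<close> and of a competitor \<open>s\<close>.\<close>

lemma top_allocation_optimal:
  assumes "finite G"
    and nonneg: "\<And>g i. g \<in> G \<Longrightarrow> i \<in> {1..d g} \<Longrightarrow> 0 \<le> lam g i"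
    and r: "top_allocation G d lam B r"
  shows "is_arg_min (tail_error G d lam) (feasible G d B) r"
proof -
  have le: "\<And>g. g \<in> G \<Longrightarrow> r g \<le> d g" and sum: "(\<Sum>g\<in>G. r g) = B"
    and top: "\<And>g i h j. \<lbrakk>g \<in> G; i \<in> {1..r g}; h \<in> G; j \<in> {r h + 1..d h}\<rbrakk> \<Longrightarrow> lam h j \<le> lam g i"
    using r assms(1) by (auto simp: top_allocation_iff)
  have "tail_error G d lam r \<le> tail_error G d lam s" if "feasible G d B s" for s
  proof -
    have s: "\<And>g. g \<in> G \<Longrightarrow> s g \<le> d g" "(\<Sum>g\<in>G. s g) \<le> B"
      using that by (auto simp: feasible_def)
    \<comment> \<open>\<open>r\<close> spends the budget exactly and \<open>s\<close> at most that
      much.\<close>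
    have "card (discarded G d r) \<le> card (discarded G d s)"
      using s le assms(1) sum by (simp only: card_discarded)
    \<comment> \<open>A position discarded by \<open>s\<close> but not by \<open>r\<close> is
      retained by \<open>r\<close>, so by \<open>top\<close> its value dominates everything that
      \<open>r\<close> discards.\<close>
    then show ?thesis
      unfolding tail_error_eq_sum_discarded[OF assms(1)]
      using assms(1) by (intro sum_le_sum_card_le) (auto intro!: top nonneg)
  qed
  then show ?thesis
    using le sum by (auto simp: is_arg_min_def feasible_def not_less)
qed

theorem corollary1:
  fixes G :: "'g set" and d :: "'g \<Rightarrow> nat" and lam :: "'g \<Rightarrow> nat \<Rightarrow> real" and B :: nat
  assumes "finite G"
    and "\<And>g. g \<in> G \<Longrightarrow> 1 \<le> d g"
    and "\<And>g. g \<in> G \<Longrightarrow> antimono_on {1..d g} (lam g)"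
    and "\<And>g i. g \<in> G \<Longrightarrow> i \<in> {1..d g} \<Longrightarrow> 0 \<le> lam g i"
    and "B \<le> (\<Sum>g\<in>G. d g)"
  shows "(\<exists>r. top_allocation G d lam B r) \<and>
         (\<forall>r. top_allocation G d lam B r \<longrightarrow>
              is_arg_min (tail_error G d lam) (feasible G d B) r)"
  using top_allocation_exists[OF assms(1,3,5)] top_allocation_optimal[OF assms(1,4)] by simp

end
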